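(* There exists a real number $d_0'>0$ such that for all $d\geq d_0'$ the following holds. Let $G$ be an $n$-vertex $(1\pm 10^{-10})d$-regular graph and let $T$ be an $n$-vertex tree. Then $$N(T;G)\leq e^{-n/1000}d^n.$$
   Context: For constants $d,\delta>0$, a graph is called $(1\pm\delta)d$-regular if every vertex degree lies in $[(1-\delta)d,(1+\delta)d]$. For an $n$-vertex graph $G$ and an $n$-vertex tree $T$, $N(T;G)$ denotes the number of labeled copies of $T$ in $G$, i.e. the number of spanning subgraphs of $G$ (as edge sets) that are isomorphic to $T$. *)

theory Defs
  imports Complex_Main "Graph_Theory.Graph_Theory"
begin

text \<open>
  A finite simple graph is a \<^locale>\<open>pair_graph\<close>: a finite loopfree digraph without parallel arcs
  whose arc relation is symmetric, each edge being represented by its two orientations. Hence the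
  degree of a vertex is its \<^const>\<open>out_degree\<close>, and a symmetric arc set is the same thing as a set of
  undirected edges.
\<close>

definition near_regular :: "real \<Rightarrow> real \<Rightarrow> 'a pair_pre_digraph \<Rightarrow> bool" where
  "near_regular \<delta> d G \<longleftrightarrow>
    (\<forall>v \<in> pverts G. (1 - \<delta>) * d \<le> real (out_degree (with_proj G) v) \<and>
                    real (out_degree (with_proj G) v) \<le> (1 + \<delta>) * d)"

text \<open>
  The library's \<^const>\<open>tree\<close> is not usable here: in a symmetric digraph it counts the
  closed walk along an edge and back as a cycle, so that no graph with an edge would be a tree. The
  cycles of an undirected graph are the directed ones of length at least 3.
\<close>

definition undirected_tree :: "'a pair_pre_digraph \<Rightarrow> bool" where
  "undirected_tree T \<longleftrightarrow>
    pair_graph T \<and> connected (with_proj T) \<and>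
    \<not> (\<exists>p. pre_digraph.cycle (with_proj T) p \<and> 3 \<le> length p)"

text \<open>
  All spanning subgraphs share the vertex set of \<open>G\<close>, so counting them is counting
  their edge sets.
\<close>

definition num_copies :: "'b pair_pre_digraph \<Rightarrow> 'a pair_pre_digraph \<Rightarrow> nat" where
  "num_copies T G =
    card {H. pair_graph H \<and> spanning (with_proj H) (with_proj G) \<and>
             digraph_iso (with_proj T) (with_proj H)}"

end

theory Submission
  imports Defs "HOL-Analysis.Harmonic_Numbers"
begin

text \<open>
  Root \<open>T\<close>. The trivial estimate, choosing the image of each vertex among the at most
  about \<open>d\<close> neighbours of the image of its parent, gives roughly
  \<open>d\<^sup>n\<close>. A constant factor per vertex is gained wherever these choices have to be
  injective, because \<open>m\<close> points have at most \<open>((d + 1) / 2)\<^sup>m\<close>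
  perfect matchings into \<open>m\<close> others if each has at most \<open>d\<close> candidates. If
  at least \<open>n / 40\<close> vertices of \<open>T\<close> have no children, embed these last:
  given the rest of the embedding, they form such a matching. Otherwise the parent function
  \<open>f\<close> of a copy, viewed as a map on the vertices of \<open>G\<close>, determines the
  copy and has an image of size at least \<open>39 n / 40\<close>. So \<open>f\<close> restricts to
  a matching between two sets of that size, and the choice of these two sets costs less than what
  the matching gains.
\<close>

subsection \<open>Counting matchings\<close>

text \<open>The induction carries the companion bound \<open>1 + sum <= prod\<close>. It settles the
  case of a product \<open>P\<close> below 2, via \<open>(2 - P) * (1 - a i) >= 0\<close>; for
  \<open>P >= 2\<close> the new factor alone adds \<open>2 * a i\<close>.\<close>

lemma two_sum_le_prod_one_plus:
  fixes a :: "'i \<Rightarrow> real"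
  assumes "finite S" and "\<And>i. i \<in> S \<Longrightarrow> 0 \<le> a i \<and> a i \<le> 1"
  shows "2 * (\<Sum>i\<in>S. a i) \<le> (\<Prod>i\<in>S. 1 + a i)"
proof -
  have "2 * (\<Sum>i\<in>S. a i) \<le> (\<Prod>i\<in>S. 1 + a i) \<and> 1 + (\<Sum>i\<in>S. a i) \<le> (\<Prod>i\<in>S. 1 + a i)"
    using assms
  proof (induction S rule: finite_induct)
    case empty
    then show ?case by simp
  next
    case (insert i S)
    define P where "P = (\<Prod>i\<in>S. 1 + a i)"
    define s where "s = (\<Sum>i\<in>S. a i)"
    have ih: "2 * s \<le> P" "1 + s \<le> P" and ai: "0 \<le> a i" "a i \<le> 1"
      using insert by (auto simp: P_def s_def)
    have s0: "0 \<le> s" unfolding s_def by (intro sum_nonneg) (use insert in auto)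
    have "P + P * a i \<ge> 2 * s + 2 * a i"
    proof (cases "P \<ge> 2")
      case True
      then have "P * a i \<ge> 2 * a i" using ai by (intro mult_right_mono) auto
      then show ?thesis using ih by linarith
    next
      case False
      then have "0 \<le> (2 - P) * (1 - a i)" using ai by (intro mult_nonneg_nonneg) auto
      then show ?thesis using ih by (simp add: algebra_simps)
    qed
    moreover have "P * a i \<ge> 1 * a i" using ai ih s0 by (intro mult_right_mono) auto
    ultimately show ?case
      using insert.hyps ih by (simp add: P_def[symmetric] s_def[symmetric] algebra_simps)
  qed
  then show ?thesis by simp
qed

text \<open>For finite \<open>X\<close> and \<open>Y\<close> of equal size their number is the
  permanent of the 0-1 matrix with rows \<open>X\<close>, columns \<open>Y\<close> and a one where
  \<open>y\<close> lies in \<open>N x\<close>. The candidates \<open>N x\<close> may reach outside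
  \<open>Y\<close>.\<close>

definition matchings :: "'x set \<Rightarrow> 'y set \<Rightarrow> ('x \<Rightarrow> 'y set) \<Rightarrow> ('x \<Rightarrow> 'y) set" where
  "matchings X Y N = {g \<in> Pi\<^sub>E X N. bij_betw g X Y}"

lemma finite_matchings:
  assumes "finite X" and "finite Y"
  shows "finite (matchings X Y N)"
proof (rule finite_subset)
  show "matchings X Y N \<subseteq> Pi\<^sub>E X (\<lambda>_. Y)"
    by (auto simp: matchings_def PiE_iff bij_betw_def extensional_def)
qed (use assms in \<open>auto intro: finite_PiE\<close>)

text \<open>Column expansion: matchings are sorted by the row \<open>x\<close> sent to
  \<open>y\<close>. Resetting that value to \<open>undefined\<close> keeps the rest extensional on
  \<open>X - {x}\<close>.\<close>

lemma matchings_insert_subset: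
  assumes "y \<notin> Y"
  shows "matchings X (insert y Y) N
    \<subseteq> (\<Union>x\<in>{x \<in> X. y \<in> N x}. (\<lambda>h. h(x := y)) ` matchings (X - {x}) Y N)"
proof
  fix g assume "g \<in> matchings X (insert y Y) N"
  then have g: "g \<in> Pi\<^sub>E X N" "inj_on g X" "g ` X = insert y Y"
    by (auto simp: matchings_def bij_betw_def)
  then obtain x where x: "x \<in> X" "g x = y" by (metis imageE insertI1)
  define h where "h = g(x := undefined)"
  have "g ` (X - {x}) = Y"
    using g x assms by (auto simp: inj_on_image_set_diff[OF g(2)])
  then have "bij_betw h (X - {x}) Y"
    using g(2) unfolding bij_betw_def h_def by (auto simp: inj_on_def image_iff)
  moreover have "h \<in> Pi\<^sub>E (X - {x}) N"
    using g(1) by (auto simp: h_def PiE_iff extensional_def)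
  moreover have "g = h(x := y)" using x by (auto simp: h_def)
  moreover have "y \<in> N x" using g(1) x by auto
  ultimately show "g \<in> (\<Union>x\<in>{x \<in> X. y \<in> N x}. (\<lambda>h. h(x := y)) ` matchings (X - {x}) Y N)"
    using x by (auto simp: matchings_def)
qed

text \<open>This is Minc's bound on the permanent of a 0-1 matrix in terms of its row sums. Expanding along
  the column of \<open>y\<close> reduces the induction step to \<open>two_sum_le_prod_one_plus\<close> with
  \<open>a x = 1 / r x\<close>, where \<open>r x\<close> is the sum of row \<open>x\<close>.\<close>

lemma card_matchings_le:
  fixes X :: "'x set" and Y :: "'y set"
  assumes "finite Y" and "finite X"
  shows "real (card (matchings X Y N)) \<le> (\<Prod>x\<in>X. (real (card (N x \<inter> Y)) + 1) / 2)"
  using assms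
proof (induction Y arbitrary: X rule: finite_induct)
  case empty
  show ?case
  proof (cases "X = {}")
    case True
    then have "matchings X {} N = {\<lambda>_. undefined}" by (auto simp: matchings_def bij_betw_def)
    with True show ?thesis by simp
  next
    case False
    then have "matchings X {} N = {}" by (auto simp: matchings_def bij_betw_def)
    then show ?thesis by (auto intro: prod_nonneg)
  qed
next
  case (insert y Y)
  define S where "S = {x \<in> X. y \<in> N x}"
  \<comment> \<open>For \<open>x\<close> in \<open>S\<close> this is the sum of row \<open>x\<close>
    over \<open>insert y Y\<close>; outside \<open>S\<close> it is that row sum plus one.\<close>
  define q where "q x = real (card (N x \<inter> Y)) + 1" for x
  have finS: "finite S" and SX: "S \<subseteq> X" using insert.prems by (auto simp: S_def)
  have q1: "q x \<ge> 1" for x by (simp add: q_def)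
  have "real (card (matchings X (insert y Y) N))
      \<le> real (card (\<Union>x\<in>S. (\<lambda>h. h(x := y)) ` matchings (X - {x}) Y N))"
    unfolding of_nat_le_iff S_def
    by (rule card_mono[OF _ matchings_insert_subset[OF insert.hyps(2)]])
       (use insert in \<open>auto intro!: finite_matchings\<close>)
  also have "\<dots> \<le> real (\<Sum>x\<in>S. card ((\<lambda>h. h(x := y)) ` matchings (X - {x}) Y N))"
    unfolding of_nat_le_iff by (rule card_UN_le[OF finS])
  also have "\<dots> \<le> (\<Sum>x\<in>S. real (card (matchings (X - {x}) Y N)))"
    unfolding of_nat_sum of_nat_le_iff
    by (intro sum_mono of_nat_mono card_image_le finite_matchings) (use insert in auto)
  also have "\<dots> \<le> (\<Sum>x\<in>S. \<Prod>x'\<in>X - {x}. q x' / 2)"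
    by (intro sum_mono) (use insert in \<open>auto simp: q_def\<close>)
  also have "\<dots> = (\<Sum>x\<in>S. (\<Prod>x'\<in>X. q x' / 2) * (2 * (1 / q x)))"
  proof (rule sum.cong)
    fix x assume "x \<in> S"
    then have "x \<in> X" using SX by auto
    then have "(\<Prod>x'\<in>X. q x' / 2) = q x / 2 * (\<Prod>x'\<in>X - {x}. q x' / 2)"
      using insert.prems by (simp add: prod.remove)
    then show "(\<Prod>x'\<in>X - {x}. q x' / 2) = (\<Prod>x'\<in>X. q x' / 2) * (2 * (1 / q x))"
      using q1[of x] by (simp add: field_simps)
  qed simp
  also have "\<dots> = (\<Prod>x'\<in>X. q x' / 2) * (2 * (\<Sum>x\<in>S. 1 / q x))"
    by (simp add: sum_distrib_left)
  also have "\<dots> \<le> (\<Prod>x'\<in>X. q x' / 2) * (\<Prod>x\<in>S. 1 + 1 / q x)"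
  proof -
    have "0 \<le> 1 / q x \<and> 1 / q x \<le> 1" for x using q1[of x] by (simp add: divide_le_eq_1)
    moreover have "0 \<le> q x / 2" for x using q1[of x] by simp
    ultimately show ?thesis
      by (intro mult_left_mono two_sum_le_prod_one_plus finS prod_nonneg) blast+
  qed
  also have "\<dots> = (\<Prod>x\<in>X - S. q x / 2) * ((\<Prod>x\<in>S. q x / 2) * (\<Prod>x\<in>S. 1 + 1 / q x))"
    using prod.subset_diff[OF SX insert.prems, of "\<lambda>x. q x / 2"] by simp
  \<comment> \<open>The factors \<open>1 + 1 / q x\<close> raise exactly the rows containing
    \<open>y\<close> from \<open>q x / 2\<close> to \<open>(q x + 1) / 2\<close>.\<close>
  also have "\<dots> = (\<Prod>x\<in>X - S. q x / 2) * (\<Prod>x\<in>S. (q x + 1) / 2)"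
  proof -
    have "q x / 2 * (1 + 1 / q x) = (q x + 1) / 2" for x using q1[of x] by (simp add: field_simps)
    then show ?thesis by (simp add: prod.distrib[symmetric])
  qed
  also have "\<dots> = (\<Prod>x\<in>X - S. (real (card (N x \<inter> insert y Y)) + 1) / 2)
      * (\<Prod>x\<in>S. (real (card (N x \<inter> insert y Y)) + 1) / 2)"
  proof -
    have "N x \<inter> insert y Y = N x \<inter> Y" if "x \<in> X - S" for x using that by (auto simp: S_def)
    moreover have "card (N x \<inter> insert y Y) = Suc (card (N x \<inter> Y))" if "x \<in> S" for x
      using that insert.hyps by (simp add: S_def Int_insert_right)
    ultimately show ?thesis by (simp add: q_def)
  qed
  also have "\<dots> = (\<Prod>x\<in>X. (real (card (N x \<inter> insert y Y)) + 1) / 2)"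
    by (rule prod.subset_diff[OF SX insert.prems, symmetric])
  finally show ?case .
qed

corollary card_matchings_le_power:
  fixes D :: real
  assumes "finite X" and "finite Y" and "\<And>x. x \<in> X \<Longrightarrow> finite (N x) \<and> real (card (N x)) \<le> D"
  shows "real (card (matchings X Y N)) \<le> ((D + 1) / 2) ^ card X"
proof -
  have "real (card (N x \<inter> Y)) \<le> D" if "x \<in> X" for x
    using assms(3)[OF that] by (meson card_mono inf_le1 of_nat_mono order_trans)
  then have "(\<Prod>x\<in>X. (real (card (N x \<inter> Y)) + 1) / 2) \<le> (\<Prod>x\<in>X. (D + 1) / 2)"
    by (intro prod_mono) auto
  then show ?thesis using card_matchings_le[OF assms(2,1), of N] by simp
qed

section \<open>Counting functions with a large image\<close>

lemma card_PiE_le_power: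
  fixes D :: real
  assumes "finite X" and "\<And>x. x \<in> X \<Longrightarrow> real (card (N x)) \<le> D"
  shows "real (card (Pi\<^sub>E X N)) \<le> D ^ card X"
proof -
  have "(\<Prod>x\<in>X. real (card (N x))) \<le> (\<Prod>x\<in>X. D)"
    using assms(2) by (intro prod_mono) auto
  then show ?thesis using assms(1) by (simp add: card_PiE)
qed

lemma card_le_fibres:
  fixes K :: real
  assumes "finite B" and "f ` A \<subseteq> B"
    and "\<And>b. b \<in> B \<Longrightarrow> finite {a \<in> A. f a = b} \<and> real (card {a \<in> A. f a = b}) \<le> K"
  shows "real (card A) \<le> real (card B) * K"
proof -
  have eq: "(\<Union>b\<in>B. {a \<in> A. f a = b}) = A" using assms(2) by auto
  have "real (card A) \<le> real (\<Sum>b\<in>B. card {a \<in> A. f a = b})"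
    using card_UN_le[OF assms(1), of "\<lambda>b. {a \<in> A. f a = b}"] unfolding eq of_nat_le_iff .
  also have "\<dots> \<le> (\<Sum>b\<in>B. K)" unfolding of_nat_sum using assms(3) by (intro sum_mono) auto
  finally show ?thesis by simp
qed

text \<open>Let \<open>Y\<close> be the image of \<open>f\<close> and \<open>X\<close> a set with
  one preimage of each point of \<open>Y\<close>. Both are \<open>k\<close>-subsets of
  \<open>V\<close>, hence the squared binomial; \<open>f\<close> is a matching from \<open>X\<close>
  to \<open>Y\<close>, and arbitrary within \<open>N\<close> on \<open>V - X\<close>.\<close>

lemma card_functions_with_image_size_le:
  fixes D :: real
  assumes "finite V" and N: "\<And>x. x \<in> V \<Longrightarrow> N x \<subseteq> V \<and> real (card (N x)) \<le> D" and "0 \<le> D"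
    and "k \<le> card V"
  shows "real (card {f \<in> Pi\<^sub>E V N. card (f ` V) = k})
    \<le> real (card V choose k) ^ 2 * (((D + 1) / 2) ^ k * D ^ (card V - k))"
proof -
  define S where "S = {X. X \<subseteq> V \<and> card X = k}"
  define F where "F X Y = {f \<in> Pi\<^sub>E V N. bij_betw f X Y}" for X Y
  have finS: "finite S" and cardS: "card S = card V choose k"
    unfolding S_def using n_subsets[OF assms(1)] assms(1) by auto
  have finN: "finite (N x)" if "x \<in> V" for x
    using N[OF that] assms(1) finite_subset by blast
  have F: "finite (F X Y) \<and> real (card (F X Y)) \<le> ((D + 1) / 2) ^ k * D ^ (card V - k)"
    if "X \<in> S" "Y \<in> S" for X Y
  proof -
    have X: "X \<subseteq> V" "card X = k" "finite X" and Y: "finite Y"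
      using that assms(1) by (auto simp: S_def intro: finite_subset)
    define M where "M = matchings X Y N \<times> Pi\<^sub>E (V - X) N"
    \<comment> \<open>A function is determined by its restrictions to \<open>X\<close> and to
      \<open>V - X\<close>.\<close>
    have "inj_on (\<lambda>f. (restrict f X, restrict f (V - X))) (F X Y)"
    proof (rule inj_onI)
      fix f g assume *: "f \<in> F X Y" "g \<in> F X Y"
        "(restrict f X, restrict f (V - X)) = (restrict g X, restrict g (V - X))"
      then have "f x = g x" if "x \<in> V" for x
        using that by (metis Diff_iff Pair_inject restrict_apply')
      then show "f = g" using * by (intro PiE_ext[of _ V N]) (auto simp: F_def)
    qed
    moreover have "(\<lambda>f. (restrict f X, restrict f (V - X))) ` F X Y \<subseteq> M"
    proof (intro image_subsetI)
      fix f assume "f \<in> F X Y"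
      then have f: "f \<in> Pi\<^sub>E V N" "bij_betw f X Y" by (auto simp: F_def)
      then have "bij_betw (restrict f X) X Y"
        by (simp add: bij_betw_def inj_on_restrict_eq)
      then show "(restrict f X, restrict f (V - X)) \<in> M"
        using f X by (auto simp: M_def matchings_def)
    qed
    moreover have "finite M"
      unfolding M_def using X Y assms(1) finN
      by (intro finite_cartesian_product finite_matchings finite_PiE) auto
    ultimately have "finite (F X Y)" "real (card (F X Y)) \<le> real (card M)"
      by (auto intro: inj_on_finite card_inj_on_le)
    moreover have "real (card M) \<le> ((D + 1) / 2) ^ card X * D ^ card (V - X)"
      unfolding M_def card_cartesian_product of_nat_mult
      using X Y assms(1) N finN subsetD[OF X(1)] \<open>0 \<le> D\<close>
      by (intro mult_mono card_matchings_le_power card_PiE_le_power) auto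
    moreover have "card (V - X) = card V - k" using X by (simp add: card_Diff_subset)
    ultimately show ?thesis using X by simp
  qed
  have "{f \<in> Pi\<^sub>E V N. card (f ` V) = k} \<subseteq> (\<Union>(X, Y)\<in>S \<times> S. F X Y)"
  proof
    fix f assume f: "f \<in> {f \<in> Pi\<^sub>E V N. card (f ` V) = k}"
    obtain X where X: "X \<subseteq> V" "inj_on f X" "f ` X = f ` V"
      by (metis subset_image_inj subset_refl)
    have "f ` V \<subseteq> V" using f N by fastforce
    then have "X \<in> S" "f ` V \<in> S" using X f card_image[OF X(2)] by (auto simp: S_def)
    moreover have "f \<in> F X (f ` V)" using X f by (auto simp: F_def bij_betw_def)
    ultimately show "f \<in> (\<Union>(X, Y)\<in>S \<times> S. F X Y)" by blast
  qed
  then have "card {f \<in> Pi\<^sub>E V N. card (f ` V) = k} \<le> card (\<Union>(X, Y)\<in>S \<times> S. F X Y)"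
    using F finS by (intro card_mono) auto
  also have "\<dots> \<le> (\<Sum>(X, Y)\<in>S \<times> S. card (F X Y))"
    using card_UN_le[of "S \<times> S" "\<lambda>(X, Y). F X Y"] finS by (simp add: case_prod_unfold)
  finally have "real (card {f \<in> Pi\<^sub>E V N. card (f ` V) = k}) \<le> (\<Sum>(X, Y)\<in>S \<times> S. real (card (F X Y)))"
    by (simp add: case_prod_unfold flip: of_nat_sum)
  also have "\<dots> \<le> (\<Sum>(X, Y)\<in>S \<times> S. ((D + 1) / 2) ^ k * D ^ (card V - k))"
    using F by (intro sum_mono) auto
  finally show ?thesis by (simp add: card_cartesian_product cardS power2_eq_square)
qed

text \<open>This isolates one term of the expansion of \<open>(1 + 1/16) ^ n\<close>. The weight
  1/16 keeps the factor exponential in \<open>n\<close> small, at the price of 16 per omitted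
  element.\<close>

lemma binomial_complement_le:
  assumes "l \<le> n"
  shows "real (n choose (n - l)) \<le> 16 ^ l * (17 / 16) ^ n"
proof -
  have "real (n choose l) * (1 / 16) ^ l \<le> (\<Sum>k\<le>n. real (n choose k) * (1 / 16) ^ k)"
    using assms by (intro member_le_sum) auto
  also have "\<dots> = (17 / 16) ^ n"
    using binomial_ring[of "1 / 16 :: real" 1 n] by simp
  finally show ?thesis
    using assms binomial_symmetric[OF assms] by (simp add: field_simps)
qed

subsection \<open>Rooted trees\<close>

text \<open>The convention \<open>par r = r\<close> makes \<open>par\<close> a self-map of
  \<open>V\<close> whose only fixed point is the root. \<open>dep\<close> need not be the distance
  to the root: strict decrease along \<open>par\<close> suffices to exclude cycles.\<close>

locale parent_tree =
  fixes V :: "'b set" and r :: 'b and par :: "'b \<Rightarrow> 'b" and dep :: "'b \<Rightarrow> nat"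
  assumes finite_V: "finite V"
    and root_in: "r \<in> V"
    and par_root: "par r = r"
    and par_in: "v \<in> V \<Longrightarrow> par v \<in> V"
    and dep_par: "v \<in> V \<Longrightarrow> v \<noteq> r \<Longrightarrow> dep (par v) < dep v"
begin

definition parent_arcs :: "'b rel" where
  "parent_arcs = (\<lambda>v. (v, par v)) ` (V - {r}) \<union> (\<lambda>v. (par v, v)) ` (V - {r})"

lemma sym_parent_arcs: "sym parent_arcs"
  by (auto simp: parent_arcs_def sym_def)

lemma root_reachable: "v \<in> V \<Longrightarrow> (v, r) \<in> parent_arcs\<^sup>*"
proof (induction "dep v" arbitrary: v rule: less_induct)
  case less
  show ?case
  proof (cases "v = r")
    case False
    with less have "(par v, r) \<in> parent_arcs\<^sup>*" by (intro less.hyps dep_par par_in)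
    moreover have "(v, par v) \<in> parent_arcs" using less.prems False by (auto simp: parent_arcs_def)
    ultimately show ?thesis by (rule converse_rtrancl_into_rtrancl[rotated])
  qed simp
qed

lemma connected_parent_arcs:
  assumes "u \<in> V" and "v \<in> V"
  shows "(u, v) \<in> parent_arcs\<^sup>*"
  using assms root_reachable sym_rtrancl[OF sym_parent_arcs]
  by (meson rtrancl_trans symD)

end

section \<open>From graph-theoretic trees to parent functions\<close>

lemma connected_imp_parent_tree:
  assumes T: "pair_graph T" and conn: "connected (with_proj T)"
  obtains r par dep where "parent_tree (pverts T) r par dep"
    and "\<And>v. v \<in> pverts T \<Longrightarrow> v \<noteq> r \<Longrightarrow> (par v, v) \<in> parcs T"
proof -
  interpret T: pair_graph T by fact
  have sym: "sym (parcs T)" using T.sym_arcs by (simp add: symmetric_def)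
  have "symcl (parcs T) = parcs T" using sym by (auto simp: symcl_def sym_def)
  \<comment> \<open>\<open>connected\<close> refers to the symmetrised digraph, which for symmetric
    \<open>T\<close> has the same reachability.\<close>
  then have sc: "strongly_connected (with_proj T)"
    using conn unfolding connected_def strongly_connected_def
    by (simp add: T.reachable_mk_symmetric_eq[OF T.sym_arcs])
  then obtain r where r: "r \<in> pverts T" by (auto simp: strongly_connected_def)
  have reach: "\<exists>k. (r, v) \<in> parcs T ^^ k" if "v \<in> pverts T" for v
  proof -
    have "reachable (with_proj T) r v" using sc r that by (auto simp: strongly_connected_def)
    then have "(r, v) \<in> (parcs T)\<^sup>*" using reachable_rtranclI by fastforce
    then show ?thesis using rtrancl_imp_relpow by blast
  qed
  \<comment> \<open>Distance from the root. Cutting the last arc off a shortest walk gives a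
    neighbour closer to the root, so the parents form a breadth-first tree.\<close>
  define dep where "dep v = (LEAST k. (r, v) \<in> parcs T ^^ k)" for v
  have dep_le: "dep v \<le> k" if "(r, v) \<in> parcs T ^^ k" for v k
    unfolding dep_def using that by (rule Least_le)
  have ex: "\<exists>u. (u, v) \<in> parcs T \<and> dep u < dep v" if v: "v \<in> pverts T" "v \<noteq> r" for v
  proof -
    have rv: "(r, v) \<in> parcs T ^^ dep v" unfolding dep_def using reach[OF v(1)] by (rule LeastI_ex)
    then obtain j where j: "dep v = Suc j" using v(2) by (cases "dep v") auto
    with rv obtain u where u: "(r, u) \<in> parcs T ^^ j" "(u, v) \<in> parcs T" by auto
    then show ?thesis using dep_le[OF u(1)] j by auto
  qed
  define par where "par v = (if v = r then r else SOME u. (u, v) \<in> parcs T \<and> dep u < dep v)" for v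
  have par: "(par v, v) \<in> parcs T \<and> dep (par v) < dep v" if "v \<in> pverts T" "v \<noteq> r" for v
    using someI_ex[OF ex[OF that]] that by (simp add: par_def)
  have "parent_tree (pverts T) r par dep"
  proof
    show "par v \<in> pverts T" if "v \<in> pverts T" for v
      using par[OF that] r T.in_arcsD1 by (cases "v = r") (auto simp: par_def)
  qed (use par r in \<open>auto simp: par_def\<close>)
  with par that show ?thesis by blast
qed

text \<open>A path in \<open>A\<close> from \<open>v\<close> to \<open>u\<close> is closed up by the
  arc \<open>(u, v)\<close>. The path has at least two arcs, because \<open>u\<close> and
  \<open>v\<close> differ and symmetry of \<open>A\<close> also excludes \<open>(v, u)\<close>; so
  the cycle has length at least 3.\<close>

lemma cycle_if_extra_arc:
  assumes T: "pair_graph T" and sub: "A \<subseteq> parcs T"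
    and uv: "(u, v) \<in> parcs T" "(u, v) \<notin> A" "sym A" and reach: "(v, u) \<in> A\<^sup>*"
  shows "\<exists>p. pre_digraph.cycle (with_proj T) p \<and> 3 \<le> length p"
proof -
  interpret T: pair_graph T by fact
  \<comment> \<open>Passing to the subgraph with arc set \<open>A\<close> turns reachability into a
    path with distinct vertices.\<close>
  define T' where "T' = \<lparr>pverts = pverts T, parcs = A\<rparr>"
  interpret T': pair_wf_digraph T'
    by unfold_locales
      (use T.arc_fst_in_verts T.arc_snd_in_verts subsetD[OF sub] in \<open>auto simp: T'_def simp del: split_paired_All\<close>)
  have V: "u \<in> pverts T" "v \<in> pverts T" using T.in_arcsD1 T.in_arcsD2 uv by auto
  have "reachable (with_proj T') v u"
    using V reach by (subst T'.reachable_conv) (auto simp: T'_def)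
  then obtain p where p: "T'.apath v p u" by (auto simp: T'.reachable_apath)
  then have "set p \<subseteq> parcs T'" and walk: "pcas v p u" and dist: "distinct (pawalk_verts v p)"
    by (auto simp: T'.apath_def T'.awalk_def)
  then have pA: "set p \<subseteq> A" by (simp add: T'_def)
  have "u \<noteq> v" using uv(1) T.no_loops by fastforce
  moreover have "(v, u) \<notin> A" using uv by (auto dest: symD)
  ultimately have len: "length p \<ge> 2" using walk pA
    by (cases p; cases "tl p") auto
  have verts: "pawalk_verts x (q @ [(u, v)]) = pawalk_verts x q @ [v]"
    and cas: "pcas x (q @ [(u, v)]) v" if "pcas x q u" for x q
    using that by (induction q arbitrary: x) auto
  have "pawalk_verts v p = v # tl (pawalk_verts v p)"
    using walk by (cases p) auto
  \<comment> \<open>The distinctness condition of \<open>cycle\<close> drops the first vertex, so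
    \<open>v\<close> may return at the end.\<close>
  then have "distinct (tl (pawalk_verts v p @ [v]))"
    using dist by (metis distinct.simps(2) distinct1_rotate list.sel(3) rotate1.simps(2) append_Cons)
  then have dist': "distinct (tl (pawalk_verts v (p @ [(u, v)])))"
    by (simp only: verts[OF walk])
  have "T.awalk v (p @ [(u, v)]) v"
    unfolding T.awalk_def using V pA sub uv cas[OF walk] by auto
  with dist' have "T.cycle (p @ [(u, v)])"
    unfolding T.cycle_def awalk_verts_with_proj_eq by blast
  then show ?thesis using len by (intro exI[of _ "p @ [(u, v)]"]) auto
qed

text \<open>The parent arcs already connect all vertices, so any further arc of \<open>T\<close>
  would close a cycle.\<close>

lemma undirected_tree_imp_parent_tree:
  assumes "undirected_tree T"
  obtains r par dep where "parent_tree (pverts T) r par dep"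
    and "parcs T = parent_tree.parent_arcs (pverts T) r par"
proof -
  have T: "pair_graph T" and conn: "connected (with_proj T)"
    and acyc: "\<not> (\<exists>p. pre_digraph.cycle (with_proj T) p \<and> 3 \<le> length p)"
    using assms by (auto simp: undirected_tree_def)
  interpret T: pair_graph T by fact
  obtain r par dep where P: "parent_tree (pverts T) r par dep"
    and par: "\<And>v. v \<in> pverts T \<Longrightarrow> v \<noteq> r \<Longrightarrow> (par v, v) \<in> parcs T"
    using connected_imp_parent_tree[OF T conn] by blast
  interpret P: parent_tree "pverts T" r par dep by fact
  have sym: "sym (parcs T)" using T.sym_arcs by (simp add: symmetric_def)
  have sub: "P.parent_arcs \<subseteq> parcs T"
    using par sym by (auto simp: P.parent_arcs_def dest: symD)
  moreover have "parcs T \<subseteq> P.parent_arcs"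
  proof (intro subrelI, rule ccontr)
    fix u v assume "(u, v) \<in> parcs T" "(u, v) \<notin> P.parent_arcs"
    then show False
      using cycle_if_extra_arc[OF T sub _ _ P.sym_parent_arcs, of u v] acyc
        P.connected_parent_arcs T.in_arcsD1 T.in_arcsD2 by blast
  qed
  ultimately show ?thesis using P that by blast
qed

section \<open>Counting homomorphisms and embeddings of a rooted tree\<close>

context parent_tree
begin

lemma card_homs_le:
  fixes K :: real
  assumes "finite W" and N: "\<And>w. w \<in> W \<Longrightarrow> finite (N w) \<and> real (card (N w)) \<le> K" and "1 \<le> K"
    and "P \<subseteq> V" and "r \<in> P" and "par ` P \<subseteq> P"
  shows "finite {\<phi> \<in> P \<rightarrow>\<^sub>E W. \<forall>v\<in>P - {r}. \<phi> v \<in> N (\<phi> (par v))} \<and>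
    real (card {\<phi> \<in> P \<rightarrow>\<^sub>E W. \<forall>v\<in>P - {r}. \<phi> v \<in> N (\<phi> (par v))}) \<le> real (card W) * K ^ card P"
  using assms(4-6)
proof (induction "card P" arbitrary: P rule: less_induct)
  case less
  define H where "H P = {\<phi> \<in> P \<rightarrow>\<^sub>E W. \<forall>v\<in>P - {r}. \<phi> v \<in> N (\<phi> (par v))}" for P
  have finP: "finite P" using less.prems finite_V finite_subset by blast
  have fin: "finite (H P)"
    unfolding H_def by (rule finite_subset[of _ "P \<rightarrow>\<^sub>E W"]) (use finP assms in \<open>auto intro!: finite_PiE\<close>)
  have "real (card (H P)) \<le> real (card W) * K ^ card P"
  proof (cases "P = {r}")
    case True
    have "card (H P) \<le> card (P \<rightarrow>\<^sub>E W)"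
      unfolding H_def by (rule card_mono) (use finP assms in \<open>auto intro!: finite_PiE\<close>)
    also have "\<dots> = card W" using True by (simp add: card_PiE)
    finally have "real (card (H P)) \<le> real (card W) * 1" by simp
    also have "\<dots> \<le> real (card W) * K" using assms(3) by (intro mult_left_mono) auto
    finally show ?thesis using True by simp
  next
    case False
    \<comment> \<open>A deepest non-root vertex of \<open>P\<close> is nobody's parent in
      \<open>P\<close>, so removing it keeps the set parent-closed.\<close>
    define m where "m = Max (dep ` (P - {r}))"
    have "m \<in> dep ` (P - {r})"
      unfolding m_def using False less.prems finP by (intro Max_in) auto
    then obtain v where v: "v \<in> P" "v \<noteq> r" "dep v = m" by auto
    have "par w \<noteq> v" if w: "w \<in> P" for w
    proof
      assume eq: "par w = v"
      then have "w \<noteq> r" using v par_root by auto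
      then have "dep v < dep w" using dep_par[of w] eq w less.prems by auto
      moreover have "dep w \<le> m" unfolding m_def using w \<open>w \<noteq> r\<close> finP by (intro Max_ge) auto
      ultimately show False using v by simp
    qed
    then have par': "par ` (P - {v}) \<subseteq> P - {v}" and pv: "par v \<in> P - {v}"
      using less.prems v by auto
    have IH: "finite (H (P - {v}))" "real (card (H (P - {v}))) \<le> real (card W) * K ^ card (P - {v})"
    proof -
      have "card (P - {v}) < card P" using finP v(1) by (rule card_Diff1_less)
      moreover have "P - {v} \<subseteq> V" "r \<in> P - {v}" using less.prems v by auto
      ultimately show "finite (H (P - {v}))" "real (card (H (P - {v}))) \<le> real (card W) * K ^ card (P - {v})"
        using less.hyps[of "P - {v}"] par' unfolding H_def by blast+
    qed
    have "real (card (H P)) \<le> real (card (H (P - {v}))) * K"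
    proof (rule card_le_fibres[OF IH(1)])
      show "(\<lambda>\<phi>. restrict \<phi> (P - {v})) ` H P \<subseteq> H (P - {v})"
        using par' by (auto simp: H_def image_subset_iff split: if_splits)
    next
      fix b assume b: "b \<in> H (P - {v})"
      have Nb: "finite (N (b (par v)))" "real (card (N (b (par v)))) \<le> K"
        using b pv N by (auto simp: H_def)
      \<comment> \<open>An extension of \<open>b\<close> is determined by its value at
        \<open>v\<close>, a neighbour of the image of the parent.\<close>
      have sub: "{\<phi> \<in> H P. restrict \<phi> (P - {v}) = b} \<subseteq> (\<lambda>a. b(v := a)) ` N (b (par v))"
      proof
        fix \<phi> assume "\<phi> \<in> {\<phi> \<in> H P. restrict \<phi> (P - {v}) = b}"
        then have \<phi>: "\<phi> \<in> H P" "b = restrict \<phi> (P - {v})" by auto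
        then have "\<phi> v \<in> N (b (par v))" using v pv by (auto simp: H_def)
        moreover have "\<phi> = b(v := \<phi> v)"
          using \<phi> by (auto simp: H_def fun_eq_iff PiE_iff extensional_def)
        ultimately show "\<phi> \<in> (\<lambda>a. b(v := a)) ` N (b (par v))" by blast
      qed
      then show "finite {\<phi> \<in> H P. restrict \<phi> (P - {v}) = b} \<and>
        real (card {\<phi> \<in> H P. restrict \<phi> (P - {v}) = b}) \<le> K"
        using Nb surj_card_le[OF Nb(1) sub] finite_surj[OF Nb(1) sub]
        by (auto intro: order_trans[OF of_nat_mono])
    qed
    also have "\<dots> \<le> real (card W) * K ^ card (P - {v}) * K"
      using IH(2) assms(3) by (intro mult_right_mono) auto
    also have "\<dots> = real (card W) * K ^ card P"
      using card_Suc_Diff1[OF finP v(1)] by (metis mult.assoc power_Suc2)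
    finally show ?thesis .
  qed
  with fin show ?case by (simp add: H_def)
qed

text \<open>The leaves are placed last: once every other vertex has been embedded, the leaves form a
  perfect matching into the remaining vertices.\<close>

lemma card_embeddings_le:
  fixes K :: real
  assumes "finite W" and N: "\<And>w. w \<in> W \<Longrightarrow> finite (N w) \<and> real (card (N w)) \<le> K" and "1 \<le> K"
  shows "real (card {\<phi> \<in> V \<rightarrow>\<^sub>E W. bij_betw \<phi> V W \<and> (\<forall>v\<in>V - {r}. \<phi> v \<in> N (\<phi> (par v)))})
    \<le> real (card W) * K ^ card (par ` V) * ((K + 1) / 2) ^ card (V - par ` V)"
proof -
  define P where "P = par ` V"
  define L where "L = V - P"
  define H where "H = {\<phi> \<in> P \<rightarrow>\<^sub>E W. \<forall>v\<in>P - {r}. \<phi> v \<in> N (\<phi> (par v))}"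
  define E where "E = {\<phi> \<in> V \<rightarrow>\<^sub>E W. bij_betw \<phi> V W \<and> (\<forall>v\<in>V - {r}. \<phi> v \<in> N (\<phi> (par v)))}"
  \<comment> \<open>Because \<open>par r = r\<close>, the root lies in \<open>P\<close> even when it
    is the only vertex, and so never counts as a leaf.\<close>
  have PV: "P \<subseteq> V" and rP: "r \<in> P" and parP: "par ` P \<subseteq> P"
    using par_in root_in par_root by (auto simp: P_def intro: rev_image_eqI)
  have finL: "finite L" using finite_V by (simp add: L_def)
  have H: "finite H" "real (card H) \<le> real (card W) * K ^ card P"
    using card_homs_le[of W N K P, OF assms(1) N assms(3) PV rP parP] unfolding H_def by blast+
  have "real (card E) \<le> real (card H) * ((K + 1) / 2) ^ card L"
  proof (rule card_le_fibres[OF H(1)])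
    show "(\<lambda>\<phi>. restrict \<phi> P) ` E \<subseteq> H"
      using PV parP by (auto simp: E_def H_def image_subset_iff)
  next
    fix b assume b: "b \<in> H"
    \<comment> \<open>Bijectivity forces the leaves to fill exactly the points that \<open>b\<close>
      leaves free.\<close>
    define M where "M = matchings L (W - b ` P) (\<lambda>v. N (b (par v)))"
    have M: "finite M" "real (card M) \<le> ((K + 1) / 2) ^ card L"
    proof -
      show "finite M" unfolding M_def using finL assms by (intro finite_matchings) auto
      have "b (par v) \<in> W" if "v \<in> L" for v
        using that b by (auto simp: H_def L_def P_def)
      then show "real (card M) \<le> ((K + 1) / 2) ^ card L"
        unfolding M_def using finL assms by (intro card_matchings_le_power) auto
    qed
    have "(\<lambda>\<phi>. restrict \<phi> L) ` {\<phi> \<in> E. restrict \<phi> P = b} \<subseteq> M"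
    proof (intro image_subsetI)
      fix \<phi> assume "\<phi> \<in> {\<phi> \<in> E. restrict \<phi> P = b}"
      then have \<phi>: "\<phi> \<in> E" and b: "b = restrict \<phi> P" by auto
      have "\<phi> ` L = W - b ` P"
        using \<phi> inj_on_image_set_diff[of \<phi> V V P] PV
        by (simp add: E_def bij_betw_def L_def b)
      moreover have "inj_on \<phi> L" using \<phi> by (auto simp: E_def bij_betw_def L_def inj_on_diff)
      ultimately have "bij_betw (restrict \<phi> L) L (W - b ` P)"
        by (simp add: bij_betw_def inj_on_restrict_eq)
      moreover have "\<phi> v \<in> N (b (par v))" if "v \<in> L" for v
        using that rP \<phi> by (auto simp: E_def L_def P_def b)
      ultimately show "restrict \<phi> L \<in> M" by (auto simp: M_def matchings_def)
    qed
    moreover have "inj_on (\<lambda>\<phi>. restrict \<phi> L) {\<phi> \<in> E. restrict \<phi> P = b}"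
    proof (rule inj_onI)
      fix \<phi> \<psi> assume *: "\<phi> \<in> {\<phi> \<in> E. restrict \<phi> P = b}" "\<psi> \<in> {\<phi> \<in> E. restrict \<phi> P = b}"
        "restrict \<phi> L = restrict \<psi> L"
      have "\<phi> v = \<psi> v" if "v \<in> V" for v
      proof (cases "v \<in> P")
        case True
        have "restrict \<phi> P v = restrict \<psi> P v" using * by auto
        then show ?thesis using True by simp
      next
        case False
        then show ?thesis using that *(3) by (metis DiffI L_def restrict_apply')
      qed
      then show "\<phi> = \<psi>" using * by (intro PiE_ext[of _ V "\<lambda>_. W"]) (auto simp: E_def)
    qed
    ultimately have "finite {\<phi> \<in> E. restrict \<phi> P = b}" "card {\<phi> \<in> E. restrict \<phi> P = b} \<le> card M"
      using M(1) by (auto intro: inj_on_finite card_inj_on_le)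
    then show "finite {\<phi> \<in> E. restrict \<phi> P = b} \<and>
      real (card {\<phi> \<in> E. restrict \<phi> P = b}) \<le> ((K + 1) / 2) ^ card L"
      using M(2) by (meson of_nat_mono order_trans)
  qed
  also have "\<dots> \<le> real (card W) * K ^ card P * ((K + 1) / 2) ^ card L"
    using H(2) assms(3) by (intro mult_right_mono) auto
  finally show ?thesis by (simp add: E_def P_def L_def)
qed

end

subsection \<open>Counting copies of a tree\<close>

lemma many_leaves_numeric:
  assumes "20000 \<le> n" and "n \<le> 40 * l"
  shows "real n * (1 / 2) ^ l \<le> exp (- real n / 500)"
proof -
  have "20000 * real n \<le> (real n)\<^sup>2"
    using assms(1) unfolding power2_eq_square by (intro mult_right_mono) auto
  moreover have "(real n / 100)\<^sup>2 = (real n)\<^sup>2 / 10000" by (simp add: power_divide)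
  \<comment> \<open>For \<open>n >= 20000\<close> the quadratic term \<open>n^2 / 20000\<close>
    alone is at least \<open>n\<close>.\<close>
  ultimately have "real n \<le> 1 + real n / 100 + (real n / 100)\<^sup>2 / 2" by linarith
  also have "\<dots> \<le> exp (real n / 100)" by (rule exp_lower_Taylor_quadratic) simp
  finally have 1: "real n \<le> exp (real n / 100)" .
  have "(1 / 2 :: real) ^ l = exp (- (real l * ln 2))"
    by (simp add: exp_minus exp_of_nat_mult power_one_over inverse_eq_divide)
  \<comment> \<open>Here \<open>l >= n/40\<close> and \<open>ln 2 >= 2/3\<close> give the rate 1/60,
    which exceeds 1/100 by more than 1/500.\<close>
  also have "\<dots> \<le> exp (- (real n / 60))"
    using mult_mono[of "real n / 40" "real l" "2 / 3" "ln 2"] ln2_ge_two_thirds assms(2) by simp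
  finally have "real n * (1 / 2) ^ l \<le> exp (real n / 100) * exp (- (real n / 60))"
    using 1 by (intro mult_mono) auto
  also have "\<dots> \<le> exp (- real n / 500)" by (simp flip: exp_add)
  finally show ?thesis .
qed

lemma few_leaves_numeric:
  assumes "40 * l \<le> n"
  shows "(16 ^ l * (17 / 16) ^ n)\<^sup>2 * (1 / 2) ^ (n - l) \<le> exp (- real n / 500)"
proof -
  have "(1 / 2 :: real) ^ (n - l) = 2 ^ l * (1 / 2) ^ n"
    using assms by (simp add: power_diff field_simps)
  then have "(16 ^ l * (17 / 16) ^ n)\<^sup>2 * (1 / 2 :: real) ^ (n - l)
      = ((16 ^ l)\<^sup>2 * 2 ^ l) * (((17 / 16) ^ n)\<^sup>2 * (1 / 2) ^ n)"
    by (simp add: power_mult_distrib)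
  also have "(16 ^ l)\<^sup>2 * 2 ^ l = (2 ^ 9 :: real) ^ l"
    by (simp add: power2_eq_square flip: power_mult_distrib)
  also have "\<dots> = exp (9 * real l * ln 2)"
  proof -
    have "exp (real (9 * l) * ln 2) = (2 :: real) ^ (9 * l)"
      by (simp only: exp_of_nat_mult) simp
    then show ?thesis by (simp add: power_mult)
  qed
  also have "(1 / 2 :: real) ^ n = exp (- (real n * ln 2))"
    by (simp add: exp_minus exp_of_nat_mult power_one_over inverse_eq_divide)
  also have "exp (9 * real l * ln 2) * (((17 / 16) ^ n)\<^sup>2 * exp (- (real n * ln 2)))
      \<le> exp (9 * real l * ln 2) * ((exp (real n / 16))\<^sup>2 * exp (- (real n * ln 2)))"
  proof -
    have "(17 / 16 :: real) ^ n \<le> exp (1 / 16) ^ n"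
      using exp_ge_add_one_self[of "1 / 16"] by (intro power_mono) auto
    then have "(17 / 16 :: real) ^ n \<le> exp (real n / 16)" by (simp flip: exp_of_nat_mult)
    then show ?thesis by (intro mult_left_mono mult_right_mono power_mono) auto
  qed
  also have "\<dots> = exp (real n / 8 - (real n - 9 * real l) * ln 2)"
    by (simp add: power2_eq_square algebra_simps flip: exp_add)
  \<comment> \<open>With \<open>l <= n/40\<close>, \<open>n - 9 * l\<close> is at least
    \<open>31 * n / 40\<close>, so the exponent is at most \<open>n/8 - 31 * n / 60\<close>.\<close>
  also have "\<dots> \<le> exp (- real n / 500)"
    using mult_mono[of "31 * real n / 40" "real n - 9 * real l" "2 / 3" "ln 2"] ln2_ge_two_thirds assms
    by simp
  finally show ?thesis .
qed

section \<open>Copies as embeddings and as parent functions\<close>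

lemma copy_embedding:
  assumes "pair_graph H" and "spanning (with_proj H) (with_proj G)"
    and "digraph_iso (with_proj T) (with_proj H)"
  obtains \<phi> where "\<phi> \<in> pverts T \<rightarrow>\<^sub>E pverts G" and "bij_betw \<phi> (pverts T) (pverts G)"
    and "H = \<lparr>pverts = pverts G, parcs = map_prod \<phi> \<phi> ` parcs T\<rparr>" and "parcs H \<subseteq> parcs G"
proof -
  obtain f where f: "pre_digraph.digraph_isomorphism (with_proj T) f"
    and H: "with_proj H = app_iso f (with_proj T)"
    using assms(3) by (auto simp: digraph_iso_def)
  have HG: "pverts H = pverts G" "parcs H \<subseteq> parcs G"
    using assms(2) by (auto simp: spanning_def subgraph_def)
  have V: "pverts H = iso_verts f ` pverts T" and A: "parcs H = iso_arcs f ` parcs T"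
    and ht: "iso_tail f = fst" "iso_head f = snd"
    using arg_cong[OF H, of verts] arg_cong[OF H, of arcs] arg_cong[OF H, of tail]
      arg_cong[OF H, of head] by auto
  define \<phi> where "\<phi> = restrict (iso_verts f) (pverts T)"
  have wf: "wf_digraph (with_proj T)" and inj: "inj_on (iso_verts f) (pverts T)"
    and arcs: "\<And>a. a \<in> parcs T \<Longrightarrow> iso_verts f (fst a) = fst (iso_arcs f a)
      \<and> iso_verts f (snd a) = snd (iso_arcs f a)"
    using f by (auto simp: pre_digraph.digraph_isomorphism_def ht)
  \<comment> \<open>Arcs of \<open>H\<close> are pairs of endpoints, so the vertex map determines
    the arc map.\<close>
  have "iso_arcs f a = map_prod \<phi> \<phi> a" if "a \<in> parcs T" for a
    using arcs[OF that] that wf_digraph.wellformed[OF wf, of a]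
    by (auto simp: \<phi>_def prod_eq_iff)
  then have "parcs H = map_prod \<phi> \<phi> ` parcs T" using A by simp
  moreover have "bij_betw \<phi> (pverts T) (pverts G)"
    using inj V HG by (simp add: bij_betw_def \<phi>_def inj_on_restrict_eq)
  moreover have "\<phi> \<in> pverts T \<rightarrow>\<^sub>E pverts G"
    using V HG by (auto simp: \<phi>_def)
  ultimately show ?thesis using HG that[of \<phi>] by (simp add: pair_pre_digraph.equality)
qed

definition nbrs :: "'a pair_pre_digraph \<Rightarrow> 'a \<Rightarrow> 'a set" where
  "nbrs G v = {w. (v, w) \<in> parcs G}"

lemma out_degree_eq_card_nbrs: "out_degree (with_proj G) v = card (nbrs G v)"
proof -
  have "out_arcs (with_proj G) v = Pair v ` nbrs G v"
    by (auto simp: out_arcs_def nbrs_def)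
  then show ?thesis by (simp add: out_degree_def card_image inj_on_def)
qed

lemma finite_nbrs: "pair_graph G \<Longrightarrow> finite (nbrs G v)"
  and nbrs_subset: "pair_graph G \<Longrightarrow> nbrs G v \<subseteq> pverts G"
proof -
  assume "pair_graph G"
  then interpret pair_graph G .
  show "nbrs G v \<subseteq> pverts G" using in_arcsD2 by (auto simp: nbrs_def)
  moreover have "finite (pverts G)" using finite_verts by simp
  ultimately show "finite (nbrs G v)" by (rule finite_subset)
qed

text \<open>Each copy is the image of at least one embedding; automorphisms of \<open>T\<close> only
  cause overcounting.\<close>

lemma num_copies_le_card_embeddings:
  fixes G :: "'a pair_pre_digraph" and T :: "'b pair_pre_digraph"
  assumes G: "pair_graph G" and "parent_tree (pverts T) r par dep"
    and T: "parcs T = parent_tree.parent_arcs (pverts T) r par"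
  shows "num_copies T G \<le> card {\<phi> \<in> pverts T \<rightarrow>\<^sub>E pverts G. bij_betw \<phi> (pverts T) (pverts G) \<and>
    (\<forall>v\<in>pverts T - {r}. \<phi> v \<in> nbrs G (\<phi> (par v)))}" (is "_ \<le> card ?E")
proof -
  interpret G: pair_graph G by fact
  interpret parent_tree "pverts T" r par dep by fact
  show ?thesis unfolding num_copies_def
  proof (rule surj_card_le)
    show "finite ?E"
      by (rule finite_subset[of _ "pverts T \<rightarrow>\<^sub>E pverts G"])
         (use finite_V G.finite_verts in \<open>auto intro!: finite_PiE\<close>)
    show "{H. pair_graph H \<and> spanning (with_proj H) (with_proj G) \<and> digraph_iso (with_proj T) (with_proj H)}
      \<subseteq> (\<lambda>\<phi>. \<lparr>pverts = pverts G, parcs = map_prod \<phi> \<phi> ` parcs T\<rparr>) ` ?E"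
    proof clarify
      fix H :: "'a pair_pre_digraph"
      assume "pair_graph H" "spanning (with_proj H) (with_proj G)" "digraph_iso (with_proj T) (with_proj H)"
      then obtain \<phi> where \<phi>: "\<phi> \<in> pverts T \<rightarrow>\<^sub>E pverts G" "bij_betw \<phi> (pverts T) (pverts G)"
        and H: "H = \<lparr>pverts = pverts G, parcs = map_prod \<phi> \<phi> ` parcs T\<rparr>" "parcs H \<subseteq> parcs G"
        by (rule copy_embedding)
      have "(\<phi> (par v), \<phi> v) \<in> parcs G" if "v \<in> pverts T - {r}" for v
      proof -
        have "(par v, v) \<in> parcs T" using that by (auto simp: T parent_arcs_def)
        then have "map_prod \<phi> \<phi> (par v, v) \<in> map_prod \<phi> \<phi> ` parcs T" by (rule imageI)
        then show ?thesis using H by auto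
      qed
      then show "H \<in> (\<lambda>\<phi>. \<lparr>pverts = pverts G, parcs = map_prod \<phi> \<phi> ` parcs T\<rparr>) ` ?E"
        using \<phi> H(1) by (intro image_eqI[of _ _ \<phi>]) (auto simp: nbrs_def)
    qed
  qed
qed

text \<open>A copy is recovered from the function taking each vertex to its parent in the copy; the root is
  the only fixed point, so it need not be recorded separately.\<close>

lemma num_copies_le_card_parent_functions:
  fixes G :: "'a pair_pre_digraph" and T :: "'b pair_pre_digraph"
  assumes G: "pair_graph G" and "parent_tree (pverts T) r par dep"
    and T: "parcs T = parent_tree.parent_arcs (pverts T) r par"
  shows "num_copies T G \<le> card {f \<in> (\<Pi>\<^sub>E x\<in>pverts G. insert x (nbrs G x)).
    card (f ` pverts G) = card (par ` pverts T)}" (is "_ \<le> card ?F")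
proof -
  interpret G: pair_graph G by fact
  interpret parent_tree "pverts T" r par dep by fact
  \<comment> \<open>Discarding the fixed point, the root of the copy, avoids a loop.\<close>
  define arcs_of where "arcs_of f =
    (\<lambda>x. (x, f x)) ` {x \<in> pverts G. f x \<noteq> x} \<union> (\<lambda>x. (f x, x)) ` {x \<in> pverts G. f x \<noteq> x}"
    for f :: "'a \<Rightarrow> 'a"
  show ?thesis unfolding num_copies_def
  proof (rule surj_card_le)
    show "finite ?F"
      by (rule finite_subset[of _ "\<Pi>\<^sub>E x\<in>pverts G. insert x (nbrs G x)"])
         (use finite_nbrs[OF G] G.finite_verts in \<open>auto intro!: finite_PiE\<close>)
    show "{H. pair_graph H \<and> spanning (with_proj H) (with_proj G) \<and> digraph_iso (with_proj T) (with_proj H)}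
      \<subseteq> (\<lambda>f. \<lparr>pverts = pverts G, parcs = arcs_of f\<rparr>) ` ?F"
    proof clarify
      fix H :: "'a pair_pre_digraph"
      assume "pair_graph H" "spanning (with_proj H) (with_proj G)" "digraph_iso (with_proj T) (with_proj H)"
      then obtain \<phi> where \<phi>: "\<phi> \<in> pverts T \<rightarrow>\<^sub>E pverts G" "bij_betw \<phi> (pverts T) (pverts G)"
        and H: "H = \<lparr>pverts = pverts G, parcs = map_prod \<phi> \<phi> ` parcs T\<rparr>" "parcs H \<subseteq> parcs G"
        by (rule copy_embedding)
      have im: "pverts G = \<phi> ` pverts T" and inj: "inj_on \<phi> (pverts T)"
        using \<phi>(2) by (auto simp: bij_betw_def)
      \<comment> \<open>The parent function of \<open>T\<close>, transported to \<open>G\<close>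
        along \<open>\<phi>\<close>; its image has as many points as that of
        \<open>par\<close>.\<close>
      define f where "f = restrict (\<lambda>x. \<phi> (par (inv_into (pverts T) \<phi> x))) (pverts G)"
      have f: "f (\<phi> v) = \<phi> (par v)" if "v \<in> pverts T" for v
        using that inj by (simp add: f_def im inv_into_f_f)
      have fixed: "f (\<phi> v) = \<phi> v \<longleftrightarrow> v = r" if "v \<in> pverts T" for v
        using that f[OF that] inj_onD[OF inj, of "par v" v] par_in[OF that] dep_par[OF that] par_root
        by (cases "v = r") auto
      have "{x \<in> pverts G. f x \<noteq> x} = \<phi> ` (pverts T - {r})"
        unfolding im using fixed by auto
      then have arcs: "arcs_of f = parcs H"
        unfolding arcs_of_def H(1) T parent_arcs_def
        by (simp add: image_Un image_image f)
      have "f x \<in> insert x (nbrs G x)" if "x \<in> pverts G" for x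
      proof (cases "f x = x")
        case False
        then have "(x, f x) \<in> arcs_of f" using that by (auto simp: arcs_of_def)
        then show ?thesis using arcs H(2) by (auto simp: nbrs_def)
      qed simp
      then have "f \<in> (\<Pi>\<^sub>E x\<in>pverts G. insert x (nbrs G x))"
        by (auto simp: f_def extensional_def)
      moreover have "f ` pverts G = \<phi> ` par ` pverts T"
        unfolding im image_image by (rule image_cong) (auto simp: f)
      then have "card (f ` pverts G) = card (par ` pverts T)"
        using par_in by (simp add: card_image inj_on_subset[OF inj] image_subset_iff)
      ultimately show "H \<in> (\<lambda>f. \<lparr>pverts = pverts G, parcs = arcs_of f\<rparr>) ` ?F"
        using H(1) arcs by (intro image_eqI[of _ _ f]) auto
    qed
  qed
qed

section \<open>Combining the two bounds\<close>

theorem theorem3p1: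
  shows "\<exists>d0 > (0::real). \<forall>d \<ge> d0. \<forall>(n::nat) (G :: 'a pair_pre_digraph) (T :: 'b pair_pre_digraph).
    pair_graph G \<longrightarrow> card (pverts G) = n \<longrightarrow> near_regular (1 / 10 ^ 10) d G \<longrightarrow>
    undirected_tree T \<longrightarrow> card (pverts T) = n \<longrightarrow>
    real (num_copies T G) \<le> exp (- real n / 1000) * d ^ n"
\<comment> \<open>The threshold \<open>10 ^ 5\<close> serves twice: the lower degree bound then
  forces \<open>n >= 20000\<close>, and the additive 2 in \<open>D + 2\<close> is absorbed into
  \<open>d / 1000\<close>.\<close>
proof (intro exI[of _ "10 ^ 5 :: real"] conjI allI impI)
  fix d :: real and n :: nat and G :: "'a pair_pre_digraph" and T :: "'b pair_pre_digraph"
  assume d: "10 ^ 5 \<le> d" and G: "pair_graph G" and nG: "card (pverts G) = n"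
    and reg: "near_regular (1 / 10 ^ 10) d G" and T: "undirected_tree T" and nT: "card (pverts T) = n"
  interpret G: pair_graph G by fact
  obtain r par dep where P: "parent_tree (pverts T) r par dep"
    and arcs: "parcs T = parent_tree.parent_arcs (pverts T) r par"
    using undirected_tree_imp_parent_tree[OF T] .
  interpret parent_tree "pverts T" r par dep by fact
  define D where "D = (1 + 1 / 10 ^ 10) * d"
  define k where "k = card (par ` pverts T)"
  define l where "l = card (pverts T - par ` pverts T)"
  have D1: "1 \<le> D" and D2: "D + 2 \<le> (1 + 1 / 1000) * d" using d by (auto simp: D_def)
  have finG: "finite (pverts G)" using G.finite_verts by simp
  have deg: "(1 - 1 / 10 ^ 10) * d \<le> real (card (nbrs G v))" "real (card (nbrs G v)) \<le> D"
    if "v \<in> pverts G" for v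
    using reg that by (auto simp: near_regular_def out_degree_eq_card_nbrs D_def)
  have sub: "par ` pverts T \<subseteq> pverts T" using par_in by auto
  have kl: "k + l = n"
    using card_Un_disjoint[of "par ` pverts T" "pverts T - par ` pverts T"] finite_V sub
    by (simp add: k_def l_def nT Un_absorb1)
  have "n > 0" using root_in finite_V nT by (auto simp: card_gt_0_iff)
  then obtain v where v: "v \<in> pverts G" using nG by fastforce
  have "(1 - 1 / 10 ^ 10) * d \<le> real n"
    using deg(1)[OF v] card_mono[OF finG nbrs_subset[OF G], of v] nG by linarith
  then have n: "20000 \<le> n" using d by simp
  \<comment> \<open>\<open>D + 2\<close> is a common base for both cases: one unit comes from the
    matching bound, the other from admitting \<open>x\<close> as its own parent.\<close>
  have "real (num_copies T G) \<le> exp (- real n / 500) * (D + 2) ^ n"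
  proof (cases "n \<le> 40 * l")
    case True
    have "real (num_copies T G) \<le> real n * D ^ k * ((D + 1) / 2) ^ l"
      using num_copies_le_card_embeddings[OF G P arcs]
        card_embeddings_le[of "pverts G" "nbrs G" D] finG finite_nbrs[OF G] deg(2) D1
      by (simp add: k_def l_def nG)
    also have "\<dots> \<le> real n * (D + 2) ^ k * ((D + 2) / 2) ^ l"
      using D1 by (intro mult_mono power_mono) auto
    also have "\<dots> = (real n * (1 / 2) ^ l) * (D + 2) ^ n"
      by (simp add: kl[symmetric] power_add power_divide)
    also have "\<dots> \<le> exp (- real n / 500) * (D + 2) ^ n"
      using many_leaves_numeric[OF n True] D1 by (intro mult_right_mono) auto
    finally show ?thesis .
  next
    case False
    have kn: "n - l = k" "n - k = l" "k \<le> n" "l \<le> n" using kl by auto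
    have "real (num_copies T G) \<le> real (n choose k) ^ 2 * (((D + 1 + 1) / 2) ^ k * (D + 1) ^ (n - k))"
    proof -
      have "insert x (nbrs G x) \<subseteq> pverts G \<and> real (card (insert x (nbrs G x))) \<le> D + 1"
        if "x \<in> pverts G" for x
        using that nbrs_subset[OF G] deg(2)[OF that] card_insert_le_m1[of "Suc (card (nbrs G x))" "nbrs G x" x]
        by auto
      then show ?thesis
        using num_copies_le_card_parent_functions[OF G P arcs] D1 kn(3)
          card_functions_with_image_size_le[of "pverts G" "\<lambda>x. insert x (nbrs G x)" "D + 1" k] finG
        by (simp add: k_def[symmetric] nG)
    qed
    also have "\<dots> \<le> (16 ^ l * (17 / 16) ^ n)\<^sup>2 * (((D + 2) / 2) ^ k * (D + 2) ^ l)"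
      using D1 binomial_complement_le[OF kn(4), unfolded kn(1)] unfolding kn(2)
      by (intro mult_mono power_mono) auto
    also have "\<dots> = (16 ^ l * (17 / 16) ^ n)\<^sup>2 * (1 / 2) ^ (n - l) * (D + 2) ^ n"
    proof -
      have "((D + 2) / 2) ^ k * (D + 2) ^ l = (1 / 2) ^ k * (D + 2) ^ (k + l)"
        by (simp add: power_add power_divide)
      then show ?thesis using kn(1) by (simp add: kl)
    qed
    also have "\<dots> \<le> exp (- real n / 500) * (D + 2) ^ n"
      using few_leaves_numeric[of l n] False D1 by (intro mult_right_mono) auto
    finally show ?thesis .
  qed
  \<comment> \<open>Replacing \<open>D + 2\<close> by \<open>d\<close> costs
    \<open>exp (n / 1000)\<close>, half of the gained exponent.\<close>
  also have "\<dots> \<le> exp (- real n / 500) * (exp (real n / 1000) * d ^ n)"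
  proof -
    have "D + 2 \<le> exp (1 / 1000) * d"
      using D2 d exp_ge_add_one_self[of "1 / 1000"]
      by (meson mult_right_mono order_trans zero_le_numeral zero_le_power)
    then have "(D + 2) ^ n \<le> (exp (1 / 1000) * d) ^ n" using D1 by (intro power_mono) auto
    then show ?thesis by (simp add: power_mult_distrib flip: exp_of_nat_mult)
  qed
  also have "\<dots> = exp (- real n / 1000) * d ^ n"
    by (simp flip: exp_add mult.assoc)
  finally show "real (num_copies T G) \<le> exp (- real n / 1000) * d ^ n" .
qed simp

end
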